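(* Let $m\ge 3$ be an integer and set $c_m:=3m^2/4$. Then for every integer $n\ge 1$, $$V_n(m)=\left(\tfrac{3m^2}{4}\right)^n\zeta_{\Delta_m}(n).$$ Moreover, let $H(w)=\prod_{j\in G_m\setminus Z}(\lambda_m(j)-w)$ be the reduced spectral polynomial of $\Delta_m$ and let $F$ be the rational function $$F(w)=-\frac{1}{m^2}\frac{H'(w)}{H(w)}.$$ Then for every integer $n\ge 1$, $$V_n(m)=3^n\left(\frac m2\right)^{2n}\cdot\frac{m^2}{(n-1)!}\,\partial_w^{\,n-1}F(w)\Big|_{w=0},$$ and $$\sum_{n\ge 1}V_n(m)\,\tau^n=c_m\tau\cdot m^2F(c_m\tau)$$ as an identity of formal power series in $\tau$ near $\tau=0$. The series on the left converges absolutely and uniformly on every closed disc $|\tau|\le R$ with $R<\frac1{c_m}\min_{j\in G_m\setminus Z}\lambda_m(j)$.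
   Context: For integers $n\ge1$, $m\ge3$, the $\mathrm{SU}(3)$ Verlinde sum is $$V_n(m)=3^nm^{2n}\sum_{\substack{(j,\ell,k)\in(\mathbb Z/m\mathbb Z\setminus\{0\})^3\\ j+\ell+k\equiv 0 \bmod m}}\Big(8\sin\frac{\pi j}{m}\sin\frac{\pi\ell}{m}\sin\frac{\pi k}{m}\Big)^{-2n}.$$ $G_m=(\mathbb Z/m\mathbb Z)^2$ is the triangular discrete torus on $m^2$ vertices: the six neighbors of $x$ are $x\pm e_1$, $x\pm e_2$, $x\pm(e_1+e_2)$, where $e_1=(1,0)$, $e_2=(0,1)$. For $d\in G_m$, $T_d$ acts on functions $f:G_m\to\mathbb C$ (the space $\ell^2(G_m)$) by $(T_df)(x)=f(x+d)$, and $\Delta_d=(T_d-I)^*(T_d-I)=2I-T_d-T_{-d}$. The higher-order Laplace operator is $\Delta_m=\frac14\Delta_{e_1}\Delta_{e_2}\Delta_{e_1+e_2}$. Its eigenvalues, counted with multiplicity, are indexed by $j=(a,b)\in G_m$ (eigenfunction $\frac1m e^{2\pi i(ax_1+bx_2)/m}$) and are $$\lambda_m(j)=16\sin^2(\pi a/m)\sin^2(\pi b/m)\sin^2(\pi(a+b)/m).$$ Let $Z=\{(a,b)\in G_m: a=0,\ b=0,\text{ or } a+b\equiv0 \bmod m\}$. The spectral zeta function (a sum over the nonzero eigenvalues) is $\zeta_{\Delta_m}(s)=\sum_{j\in G_m\setminus Z}\lambda_m(j)^{-s}$. *)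

theory Defs
  imports "HOL-Analysis.Analysis" "HOL-Number_Theory.Cong"
begin

text \<open>
  Elements of the cyclic group of order \<open>m\<close> are represented by the integers \<open>0, \<dots>, m - 1\<close>.
  The squares of the sines used below do not depend on the choice of representatives.
\<close>

definition verlinde :: "nat \<Rightarrow> nat \<Rightarrow> real" where
  "verlinde n m = 3 ^ n * real m ^ (2 * n) *
     (\<Sum>(j, l, k) \<in> {(j, l, k). j \<in> {0..<int m} - {0} \<and> l \<in> {0..<int m} - {0} \<and>
                              k \<in> {0..<int m} - {0} \<and> [j + l + k = 0] (mod int m)}.
        (8 * sin (pi * real_of_int j / m) * sin (pi * real_of_int l / m) *
           sin (pi * real_of_int k / m)) powi (- 2 * int n))"

definition torus :: "nat \<Rightarrow> (int \<times> int) set" where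
  "torus m = {0..<int m} \<times> {0..<int m}"

subsection \<open>The higher-order Laplace operator\<close>

text \<open>
  A function on \<open>torus m\<close> is represented by a function on \<open>int \<times> int\<close> of which only the values
  on \<open>torus m\<close> matter.
\<close>

definition shift :: "nat \<Rightarrow> int \<times> int \<Rightarrow> (int \<times> int \<Rightarrow> complex) \<Rightarrow> int \<times> int \<Rightarrow> complex" where
  "shift m d f = (\<lambda>(x, y). f ((x + fst d) mod int m, (y + snd d) mod int m))"

definition laplace_dir :: "nat \<Rightarrow> int \<times> int \<Rightarrow> (int \<times> int \<Rightarrow> complex) \<Rightarrow> int \<times> int \<Rightarrow> complex" where
  "laplace_dir m d f = (\<lambda>x. 2 * f x - shift m d f x - shift m (- fst d, - snd d) f x)"

definition laplace :: "nat \<Rightarrow> (int \<times> int \<Rightarrow> complex) \<Rightarrow> int \<times> int \<Rightarrow> complex" where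
  "laplace m f =
     (\<lambda>x. 1 / 4 * laplace_dir m (1, 0) (laplace_dir m (0, 1) (laplace_dir m (1, 1) f)) x)"

definition eigenfun :: "nat \<Rightarrow> int \<times> int \<Rightarrow> int \<times> int \<Rightarrow> complex" where
  "eigenfun m = (\<lambda>(a, b) (x, y). cis (2 * pi * real_of_int (a * x + b * y) / m) / m)"

definition eigval :: "nat \<Rightarrow> int \<times> int \<Rightarrow> real" where
  "eigval m = (\<lambda>(a, b). 16 * (sin (pi * real_of_int a / m))\<^sup>2 *
     (sin (pi * real_of_int b / m))\<^sup>2 * (sin (pi * real_of_int (a + b) / m))\<^sup>2)"

subsection \<open>Spectral functions\<close>

definition zero_modes :: "nat \<Rightarrow> (int \<times> int) set" where
  "zero_modes m = {(a, b) \<in> torus m. a = 0 \<or> b = 0 \<or> [a + b = 0] (mod int m)}"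

definition spectral_zeta :: "nat \<Rightarrow> complex \<Rightarrow> complex" where
  "spectral_zeta m s = (\<Sum>j \<in> torus m - zero_modes m. of_real (eigval m j) powr (- s))"

definition red_spec_poly :: "nat \<Rightarrow> complex poly" where
  "red_spec_poly m = (\<Prod>j \<in> torus m - zero_modes m. [:of_real (eigval m j), - 1:])"

definition ratF :: "nat \<Rightarrow> complex \<Rightarrow> complex" where
  "ratF m w = - (1 / of_nat m ^ 2) * (poly (pderiv (red_spec_poly m)) w / poly (red_spec_poly m) w)"

definition verlinde_scale :: "nat \<Rightarrow> real" where
  "verlinde_scale m = 3 * real m ^ 2 / 4"

subsection \<open>The spectrum of the operator\<close>

lemma shift_eigenfun:
  assumes "m > 0"
  shows "shift m d (eigenfun m j) x =
    cis (2 * pi * real_of_int (fst j * fst d + snd j * snd d) / m) * eigenfun m j x"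
proof -
  obtain a b where j: "j = (a, b)" by force
  obtain u v where x: "x = (u, v)" by force
  obtain p q where d: "d = (p, q)" by force
  define k where "k = a * ((u + p) div int m) + b * ((v + q) div int m)"
  have "a * ((u + p) mod int m) + b * ((v + q) mod int m)
      = (a * p + b * q) + (a * u + b * v) - int m * k"
    unfolding k_def by (simp add: minus_div_mult_eq_mod [symmetric] algebra_simps)
  hence "real_of_int (a * ((u + p) mod int m) + b * ((v + q) mod int m)) =
      (a * p + b * q) + (a * u + b * v) - real m * k"
    by (metis of_int_diff of_int_add of_int_mult of_int_of_nat_eq)
  hence "2 * pi * (a * ((u + p) mod int m) + b * ((v + q) mod int m)) / m =
      2 * pi * (a * p + b * q) / m + 2 * pi * (a * u + b * v) / m + 2 * pi * of_int (- k)"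
    using assms by (simp only: of_int_minus) (simp add: divide_simps, simp add: algebra_simps)
  moreover have "cis (2 * pi * of_int (- k)) = 1"
    by (rule cis_multiple_2pi) simp
  ultimately have "cis (2 * pi * (a * ((u + p) mod int m) + b * ((v + q) mod int m)) / m) =
      cis (2 * pi * (a * p + b * q) / m) * cis (2 * pi * (a * u + b * v) / m)"
    by (metis cis_mult mult.right_neutral)
  thus ?thesis
    by (simp add: shift_def eigenfun_def j x d)
qed

lemma laplace_dir_eigenfun:
  assumes "m > 0"
  shows "laplace_dir m d (\<lambda>x. c * eigenfun m j x) x =
    4 * (sin (pi * real_of_int (fst j * fst d + snd j * snd d) / m))\<^sup>2 * c * eigenfun m j x"
proof -
  define t where "t = pi * real_of_int (fst j * fst d + snd j * snd d) / m"
  have sh: "shift m d' (\<lambda>x. c * eigenfun m j x) x = c * shift m d' (eigenfun m j) x" for d'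
    by (simp add: shift_def split: prod.split)
  have 1: "2 * pi * real_of_int (fst j * fst d + snd j * snd d) / m = 2 * t"
    by (simp add: t_def)
  have 2: "2 * pi * real_of_int (fst j * (- fst d) + snd j * (- snd d)) / m = - (2 * t)"
    by (simp add: t_def minus_divide_left algebra_simps)
  have "2 - cis (2 * t) - cis (- (2 * t)) = of_real (2 - 2 * cos (2 * t))"
    by (simp add: complex_eq_iff)
  also have "2 - 2 * cos (2 * t) = 4 * (sin t)\<^sup>2"
    by (simp add: cos_double_sin)
  finally have 3: "2 - cis (2 * t) - cis (- (2 * t)) = of_real (4 * (sin t)\<^sup>2)" .
  have "laplace_dir m d (\<lambda>x. c * eigenfun m j x) x
      = (2 - cis (2 * t) - cis (- (2 * t))) * c * eigenfun m j x"
    using 1 2 by (simp add: laplace_dir_def sh shift_eigenfun assms algebra_simps)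
  thus ?thesis unfolding 3 by (simp add: t_def)
qed

theorem laplace_eigenfun:
  assumes "m > 0"
  shows "laplace m (eigenfun m j) x = of_real (eigval m j) * eigenfun m j x"
proof -
  have A: "laplace_dir m d (\<lambda>x. (c::complex) * eigenfun m j x) =
      (\<lambda>x. (4 * (sin (pi * real_of_int (fst j * fst d + snd j * snd d) / m))\<^sup>2 * c) * eigenfun m j x)" for d c
    using laplace_dir_eigenfun [OF assms] by (intro ext) simp
  have B: "laplace_dir m (1, 1) (eigenfun m j) =
      (\<lambda>x. (4 * (sin (pi * real_of_int (fst j + snd j) / m))\<^sup>2) * eigenfun m j x)"
    using A[of "(1, 1)" 1] by simp
  show ?thesis
    unfolding laplace_def B A by (simp add: eigval_def case_prod_beta)
qed

lemma sum_roots_unity: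
  assumes "m > 0" "\<bar>k\<bar> < int m"
  shows "(\<Sum>x \<in> {0..<int m}. cis (2 * pi * (k * x) / m)) = (if k = 0 then of_nat m else 0)"
proof (cases "k = 0")
  case True
  thus ?thesis by simp
next
  case False
  define z where "z = cis (2 * pi * k / m)"
  have "z \<noteq> 1"
  proof
    assume "z = 1"
    hence "cos (2 * pi * k / m) = 1" by (simp add: z_def complex_eq_iff)
    then obtain i :: int where "2 * pi * k / m = of_int i * 2 * pi"
      using cos_one_2pi_int by blast
    hence "real_of_int k = of_int (i * int m)"
      using assms(1) by (simp add: field_simps)
    hence "k = i * int m" by linarith
    thus False using False assms by (metis abs_mult abs_of_nat dvd_triv_right zdvd_not_zless
        abs_of_pos dvd_abs_iff zero_less_abs_iff)
  qed
  have "real m * (2 * pi * k / m) = 2 * pi * k" using assms by simp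
  hence "z ^ m = cis (2 * pi * k)" unfolding z_def Complex.DeMoivre by (rule arg_cong)
  hence zm: "z ^ m = 1" by (simp add: cis_multiple_2pi)
  have "(\<Sum>x \<in> {0..<int m}. cis (2 * pi * (k * x) / m)) = (\<Sum>i<m. z ^ i)"
    by (rule sum.reindex_bij_witness[of _ int nat])
       (auto simp: z_def Complex.DeMoivre mult_ac)
  also have "\<dots> = 0" using \<open>z \<noteq> 1\<close> zm by (simp add: geometric_sum)
  finally show ?thesis using False by simp
qed

text \<open>
  The \<open>m\<^sup>2\<close> eigenfunctions are orthonormal, so they form a basis of the functions on
  \<open>torus m\<close>, and \<open>eigval m j\<close>, for \<open>j \<in> torus m\<close>, lists the eigenvalues of the operator with
  multiplicity.
\<close>

theorem eigenfun_orthonormal: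
  assumes "m > 0" "i \<in> torus m" "j \<in> torus m"
  shows "(\<Sum>x \<in> torus m. eigenfun m i x * cnj (eigenfun m j x)) = (if i = j then 1 else 0)"
proof -
  obtain a b where i: "i = (a, b)" by force
  obtain c d where j: "j = (c, d)" by force
  have lt: "\<bar>a - c\<bar> < int m" "\<bar>b - d\<bar> < int m"
    using assms by (auto simp: torus_def i j)
  have "(\<Sum>x \<in> torus m. eigenfun m i x * cnj (eigenfun m j x)) =
      (\<Sum>(x, y) \<in> torus m. cis (2 * pi * real_of_int ((a - c) * x) / m) *
        cis (2 * pi * real_of_int ((b - d) * y) / m) / of_nat m ^ 2)"
    by (intro sum.cong)
       (auto simp: eigenfun_def i j cis_cnj cis_mult power2_eq_square diff_divide_distrib
          add_divide_distrib algebra_simps)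
  also have "\<dots> = (\<Sum>x \<in> {0..<int m}. cis (2 * pi * ((a - c) * x) / m)) *
      (\<Sum>y \<in> {0..<int m}. cis (2 * pi * ((b - d) * y) / m)) / of_nat m ^ 2"
    unfolding torus_def sum_product sum.cartesian_product sum_divide_distrib by (simp add: case_prod_beta)
  also have "\<dots> = (if i = j then 1 else 0)"
    using sum_roots_unity [OF assms(1) lt(1)] sum_roots_unity [OF assms(1) lt(2)] assms(1)
    by (simp add: i j power2_eq_square)
  finally show ?thesis .
qed

text \<open>
  \<open>laplace_dir m d\<close> is the product of \<open>T - I\<close> with its adjoint, where \<open>T = shift m d\<close>.
\<close>

lemma sum_shift:
  assumes "m > 0"
  shows "(\<Sum>x \<in> torus m. shift m d h x) = (\<Sum>x \<in> torus m. h x)"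
  by (rule sum.reindex_bij_witness
        [of _ "\<lambda>(x, y). ((x - fst d) mod int m, (y - snd d) mod int m)"
              "\<lambda>(x, y). ((x + fst d) mod int m, (y + snd d) mod int m)"])
     (use assms in \<open>auto simp: torus_def shift_def mod_simps\<close>)

theorem laplace_dir_adjoint:
  assumes "m > 0"
  shows "(\<Sum>x \<in> torus m. laplace_dir m d f x * cnj (g x)) =
    (\<Sum>x \<in> torus m. (shift m d f x - f x) * cnj (shift m d g x - g x))"
proof -
  have 1: "(\<Sum>x \<in> torus m. shift m d f x * cnj (shift m d g x)) = (\<Sum>x \<in> torus m. f x * cnj (g x))"
    using sum_shift[OF assms, of d "\<lambda>x. f x * cnj (g x)"]
    by (simp add: shift_def case_prod_beta)
  have "(\<Sum>x \<in> torus m. shift m (- fst d, - snd d) f x * cnj (g x)) =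
      (\<Sum>x \<in> torus m. shift m d (\<lambda>x. shift m (- fst d, - snd d) f x * cnj (g x)) x)"
    by (simp add: sum_shift[OF assms])
  also have "\<dots> = (\<Sum>x \<in> torus m. f x * cnj (shift m d g x))"
    by (rule sum.cong) (auto simp: torus_def shift_def mod_simps)
  finally have 2: "(\<Sum>x \<in> torus m. shift m (- fst d, - snd d) f x * cnj (g x)) =
      (\<Sum>x \<in> torus m. f x * cnj (shift m d g x))" .
  show ?thesis
    using 1 2 by (simp add: laplace_dir_def algebra_simps sum.distrib sum_subtractf
      sum_distrib_left)
qed

end

theory Submission
  imports Defs
begin

text \<open>
  In a Verlinde triple, \<open>k\<close> is determined by \<open>(j, l)\<close>, and \<open>(8 sin sin sin)\<^sup>2\<close> is four times the
  eigenvalue at \<open>(j, l)\<close>; so \<open>verlinde n m\<close> is the \<open>n\<close>-th power sum of the numbers \<open>c / \<lambda>\<close>. The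
  logarithmic derivative of the reduced spectral polynomial is a sum of simple poles \<open>1 / (\<lambda> - w)\<close>
  up to sign, and expanding these as geometric series gives the power sums as Taylor coefficients.
\<close>

section \<open>Eigenvalues and the Verlinde sum as a power sum\<close>

lemma sin_pi_int_div_eq_0_iff:
  assumes "m > 0"
  shows "sin (pi * real_of_int a / real m) = 0 \<longleftrightarrow> int m dvd a"
proof -
  have "pi * real_of_int a / real m = of_int i * pi \<longleftrightarrow> a = int m * i" for i
  proof -
    have "pi * real_of_int a / real m = of_int i * pi \<longleftrightarrow> real_of_int a = of_int (int m * i)"
      using assms by (simp add: field_simps)
    thus ?thesis by (simp only: of_int_eq_iff)
  qed
  thus ?thesis by (simp add: sin_zero_iff_int2 dvd_def)
qed

text \<open>The two angles add up to an integer multiple of pi, so their sines agree up to sign. It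
  replaces the third sine of a Verlinde triple by the sine of the sum of the first two
  indices.\<close>

lemma sin_squared_pi_int_div_cong:
  assumes "m > 0" "[j + k = 0] (mod int m)"
  shows "(sin (pi * real_of_int k / real m))\<^sup>2 = (sin (pi * real_of_int j / real m))\<^sup>2"
proof -
  obtain q where "j + k = int m * q"
    using assms(2) by (auto simp: cong_0_iff dvd_def)
  hence "k = int m * q - j" by simp
  hence "real_of_int k = real m * of_int q - of_int j" by simp
  hence "pi * real_of_int k / real m = pi * of_int q - pi * real_of_int j / real m"
    using assms(1) by (simp add: right_diff_distrib diff_divide_distrib)
  moreover have "sin (pi * real_of_int q) = 0"
    by (simp add: sin_zero_iff_int2)
  \<comment> \<open>As the sine of pi q is zero, its cosine has square 1: the sign is lost on
    squaring.\<close>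
  ultimately show ?thesis
    using sin_cos_squared_add [of "pi * real_of_int q"]
    by (simp add: sin_diff power_mult_distrib)
qed

lemma finite_modes: "finite (torus m - zero_modes m)"
  by (simp add: torus_def)

text \<open>The zero modes are exactly the points of the torus where one of the three sines
  vanishes.\<close>

lemma eigval_pos:
  assumes "j \<in> torus m - zero_modes m"
  shows "eigval m j > 0"
proof -
  obtain a b where j: "j = (a, b)" by force
  have "m > 0" and "\<not> int m dvd a" and "\<not> int m dvd b" and "\<not> int m dvd a + b"
    using assms by (auto simp: j torus_def zero_modes_def cong_0_iff dest: zdvd_imp_le)
  thus ?thesis
    by (simp add: eigval_def j sin_pi_int_div_eq_0_iff del: of_int_add)
qed

lemma verlinde_conv_eigval:
  assumes "m > 0"
  shows "verlinde n m = (\<Sum>j \<in> torus m - zero_modes m. (verlinde_scale m / eigval m j) ^ n)"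
proof -
  let ?T = "{(j, l, k). j \<in> {0..<int m} - {0} \<and> l \<in> {0..<int m} - {0} \<and>
              k \<in> {0..<int m} - {0} \<and> [j + l + k = 0] (mod int m)}"
  have "verlinde n m = (\<Sum>(j, l, k) \<in> ?T. 3 ^ n * real m ^ (2 * n) *
        (8 * sin (pi * real_of_int j / m) * sin (pi * real_of_int l / m) *
           sin (pi * real_of_int k / m)) powi (- 2 * int n))"
    by (simp add: verlinde_def sum_distrib_left case_prod_beta)
  also have "\<dots> = (\<Sum>j \<in> torus m - zero_modes m. (verlinde_scale m / eigval m j) ^ n)"
  \<comment> \<open>The third index must be the representative of -(a + b) between 0 and m - 1,
    hence the \<open>mod\<close>.\<close>
  proof (rule sum.reindex_bij_witness
      [of _ "\<lambda>(a, b). (a, b, (- (a + b)) mod int m)" "\<lambda>(j, l, k). (j, l)"])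
    fix t assume t: "t \<in> ?T"
    obtain j l k where tt: "t = (j, l, k)" by (cases t) auto
    have jlk: "0 < k" "k < int m" "[j + l + k = 0] (mod int m)"
      using t by (auto simp: tt)
    have k: "k = (- (j + l)) mod int m"
    proof -
      have "[k = - (j + l)] (mod int m)"
        using jlk(3) by (simp add: cong_iff_dvd_diff algebra_simps)
      thus ?thesis using jlk by (simp add: cong_def)
    qed
    show "(case case t of (j, l, k) \<Rightarrow> (j, l) of (a, b) \<Rightarrow> (a, b, (- (a + b)) mod int m)) = t"
      by (simp add: tt k)
    \<comment> \<open>The third index being nonzero is what keeps (j, l) off the line j + l = 0 of
      zero modes.\<close>
    have "\<not> int m dvd - (j + l)"
      using jlk(1) unfolding k by (auto simp del: minus_add_distrib)
    hence "\<not> int m dvd j + l"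
      by (simp only: dvd_minus_iff not_False_eq_True)
    thus "(case t of (j, l, k) \<Rightarrow> (j, l)) \<in> torus m - zero_modes m"
      using t by (auto simp: tt torus_def zero_modes_def cong_0_iff)
    \<comment> \<open>The square has constant 64 and the eigenvalue has 16; this quotient 4 is the
      denominator of \<open>verlinde_scale\<close>.\<close>
    have "(8 * sin (pi * real_of_int j / m) * sin (pi * real_of_int l / m) *
        sin (pi * real_of_int k / m)) ^ 2 = 4 * eigval m (j, l)"
      using sin_squared_pi_int_div_cong [OF assms jlk(3)]
      by (simp add: eigval_def power_mult_distrib del: of_int_add)
    moreover have "x powi (- 2 * int n) = 1 / (x\<^sup>2) ^ n" for x :: real
    proof -
      have "x powi (- 2 * int n) = x powi (- int (2 * n))" by simp
      also have "\<dots> = 1 / (x\<^sup>2) ^ n"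
        unfolding power_int_minus power_int_of_nat power_mult by (rule inverse_eq_divide)
      finally show ?thesis .
    qed
    ultimately have "3 ^ n * real m ^ (2 * n) *
          (8 * sin (pi * real_of_int j / m) * sin (pi * real_of_int l / m) *
           sin (pi * real_of_int k / m)) powi (- 2 * int n) =
         3 ^ n * real m ^ (2 * n) * (1 / (4 * eigval m (j, l)) ^ n)"
      by (simp only:)
    thus "(\<lambda>j. (verlinde_scale m / eigval m j) ^ n) (case t of (j, l, k) \<Rightarrow> (j, l)) =
        (case t of (j, l, k) \<Rightarrow> 3 ^ n * real m ^ (2 * n) *
          (8 * sin (pi * real_of_int j / m) * sin (pi * real_of_int l / m) *
           sin (pi * real_of_int k / m)) powi (- 2 * int n))"
      by (simp only: tt prod.case) (simp add: verlinde_scale_def power_divide power_mult_distrib power_mult)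
  next
    fix p assume p: "p \<in> torus m - zero_modes m"
    obtain a b where ab: "p = (a, b)" by force
    have "(- (a + b)) mod int m \<noteq> 0"
      using p by (auto simp: ab zero_modes_def cong_0_iff mod_eq_0_iff_dvd dvd_minus_iff
          simp del: minus_add_distrib)
    moreover have "[a + b + (- (a + b)) mod int m = 0] (mod int m)"
      by (simp add: cong_def mod_simps)
    ultimately show "(case p of (a, b) \<Rightarrow> (a, b, (- (a + b)) mod int m)) \<in> ?T"
      using p assms by (auto simp: ab torus_def zero_modes_def)
  qed (auto)
  finally show ?thesis .
qed

section \<open>Logarithmic derivative and its power series\<close>

lemma logderiv_prod_linear:
  fixes f :: "'a \<Rightarrow> 'b :: field_char_0"
  assumes "finite A" "\<And>a. a \<in> A \<Longrightarrow> f a \<noteq> w"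
  shows "poly (pderiv (\<Prod>a\<in>A. [:f a, - 1:])) w / poly (\<Prod>a\<in>A. [:f a, - 1:]) w =
    - (\<Sum>a\<in>A. 1 / (f a - w))"
  using assms
proof (induction A rule: finite_induct)
  case (insert a A)
  define P where "P = (\<Prod>a\<in>A. [:f a, - 1:])"
  have nz: "poly P w \<noteq> 0" "f a - w \<noteq> 0"
    using insert by (auto simp: P_def poly_prod)
  have lin: "poly [:f a, - 1:] w = f a - w" "poly (pderiv [:f a, - 1:]) w = - 1"
    by (simp_all add: pderiv_pCons)
  \<comment> \<open>The product rule divided by the product: each factor contributes its own pole,
    so repeated values count with multiplicity.\<close>
  have "poly (pderiv ([:f a, - 1:] * P)) w / poly ([:f a, - 1:] * P) w =
      poly (pderiv P) w / poly P w - 1 / (f a - w)"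
    unfolding pderiv_mult poly_add poly_mult lin using nz by (simp add: divide_simps)
  thus ?case
    using insert by (simp add: P_def del: mult_pCons_left)
qed simp

text \<open>The minus signs of \<open>ratF\<close> and of the logarithmic derivative cancel, leaving
  a finite sum of 1 / (\<lambda> - w), each a geometric series in w / \<lambda>. The factor 1 /
  \<lambda> in front raises the exponent, so the coefficient of w^n holds the power sum of order n +
  1.\<close>

lemma ratF_sums:
  assumes "m > 0"
    and "\<And>j. j \<in> torus m - zero_modes m \<Longrightarrow> norm w < eigval m j"
  shows "(\<lambda>n. (\<Sum>j \<in> torus m - zero_modes m. of_real (1 / eigval m j) ^ Suc n) / of_nat m ^ 2 * w ^ n)
    sums ratF m w"
proof -
  let ?L = "torus m - zero_modes m"
  have "(\<lambda>n. \<Sum>j\<in>?L. of_real (1 / eigval m j) * (w / of_real (eigval m j)) ^ n)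
      sums (\<Sum>j\<in>?L. of_real (1 / eigval m j) * (1 / (1 - w / of_real (eigval m j))))"
  proof (intro sums_sum sums_mult geometric_sums)
    fix j assume "j \<in> ?L"
    thus "norm (w / of_real (eigval m j)) < 1"
      using assms(2) [of j] eigval_pos [of j m] by (simp add: norm_divide)
  qed
  also have "(\<Sum>j\<in>?L. of_real (1 / eigval m j) * (1 / (1 - w / of_real (eigval m j)))) =
      (\<Sum>j\<in>?L. 1 / (of_real (eigval m j) - w))"
  proof (rule sum.cong [OF refl])
    fix j assume "j \<in> ?L"
    thus "of_real (1 / eigval m j) * (1 / (1 - w / of_real (eigval m j))) =
        1 / (of_real (eigval m j) - w)"
      using eigval_pos [of j m] by (simp add: field_simps)
  qed
  also have "\<dots> = of_nat m ^ 2 * ratF m w"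
  proof -
    have "of_real (eigval m j) \<noteq> w" if "j \<in> ?L" for j
      using assms(2) [OF that] by auto
    thus ?thesis
      using assms(1) logderiv_prod_linear [OF finite_modes, of m "\<lambda>j. of_real (eigval m j)" w]
      by (simp add: ratF_def red_spec_poly_def)
  qed
  finally have "(\<lambda>n. (\<Sum>j\<in>?L. of_real (1 / eigval m j) * (w / of_real (eigval m j)) ^ n) / of_nat m ^ 2)
      sums (of_nat m ^ 2 * ratF m w / of_nat m ^ 2)"
    by (rule sums_divide)
  moreover have "of_nat m ^ 2 * ratF m w / of_nat m ^ 2 = ratF m w"
    using assms(1) by simp
  moreover have "(\<Sum>j\<in>?L. of_real (1 / eigval m j) * (w / of_real (eigval m j)) ^ n) / of_nat m ^ 2 =
      (\<Sum>j\<in>?L. of_real (1 / eigval m j) ^ Suc n) / of_nat m ^ 2 * w ^ n" for n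
    by (simp add: sum_distrib_right sum_divide_distrib power_divide)
  ultimately show ?thesis
    by (simp only:)
qed

text \<open>There are finitely many modes, all with positive eigenvalue, so one neighbourhood of 0
  serves them all.\<close>

lemma eventually_norm_less_eigval:
  "eventually (\<lambda>w :: complex. \<forall>j \<in> torus m - zero_modes m. norm w < eigval m j) (nhds 0)"
proof -
  have "eventually (\<lambda>w :: complex. norm w < eigval m j) (nhds 0)" if "j \<in> torus m - zero_modes m" for j
    using eigval_pos [OF that] by (auto simp: eventually_nhds_metric)
  thus ?thesis
    by (simp add: eventually_ball_finite_distrib finite_modes del: Diff_iff)
qed

lemma of_real_verlinde_conv_eigval:
  assumes "m > 0"
  shows "of_real (verlinde n m) = of_real (verlinde_scale m) ^ n *
    (\<Sum>j \<in> torus m - zero_modes m. of_real (1 / eigval m j) ^ n :: complex)"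
  unfolding verlinde_conv_eigval [OF assms]
  by (simp add: sum_distrib_left power_divide)

section \<open>Zeta values, Taylor coefficients, generating function and convergence\<close>

theorem theorem1p1:
  fixes m :: nat
  assumes "m \<ge> 3"
  shows "(\<forall>n\<ge>1. of_real (verlinde n m) = (3 * of_nat m ^ 2 / 4) ^ n * spectral_zeta m (of_nat n))
    \<and> (\<forall>n\<ge>1. of_real (verlinde n m) =
          3 ^ n * (of_nat m / 2) ^ (2 * n) * (of_nat m ^ 2 / fact (n - 1)) * (deriv ^^ (n - 1)) (ratF m) 0)
    \<and> (\<lambda>\<tau>. of_real (verlinde_scale m) * \<tau> * of_nat m ^ 2 * ratF m (of_real (verlinde_scale m) * \<tau>))
          has_fps_expansion Abs_fps (\<lambda>n. if n = 0 then 0 else of_real (verlinde n m))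
    \<and> (\<forall>R. R < Min (eigval m ` (torus m - zero_modes m)) / verlinde_scale m \<longrightarrow>
          (\<forall>\<tau>\<in>cball (0::complex) R. summable (\<lambda>n. norm (of_real (verlinde (Suc n) m) * \<tau> ^ Suc n)))
          \<and> uniformly_convergent_on (cball (0::complex) R)
                (\<lambda>N \<tau>. \<Sum>n=1..N. of_real (verlinde n m) * \<tau> ^ n))"
proof (intro conjI allI impI ballI)
  have m: "m > 0" using assms by simp
  let ?L = "torus m - zero_modes m" and ?c = "verlinde_scale m"
  have c: "?c > 0" using m by (simp add: verlinde_scale_def)
  have sc: "of_real ?c = (3 * of_nat m ^ 2 / 4 :: complex)"
    by (simp add: verlinde_scale_def)
  {
    fix n :: nat
    \<comment> \<open>A nonzero base and an integer exponent turn the complex \<open>powr\<close>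
      into an ordinary power.\<close>
    have "of_real (eigval m j) powr (- of_nat n) = (of_real (1 / eigval m j) ^ n :: complex)"
      if "j \<in> ?L" for j
      using eigval_pos [OF that] by (simp add: powr_minus powr_nat' power_inverse divide_inverse)
    hence "spectral_zeta m (of_nat n) = (\<Sum>j\<in>?L. of_real (1 / eigval m j) ^ n)"
      unfolding spectral_zeta_def by (intro sum.cong) auto
    thus "of_real (verlinde n m) = (3 * of_nat m ^ 2 / 4) ^ n * spectral_zeta m (of_nat n)"
      using of_real_verlinde_conv_eigval [OF m, of n] by (simp only: sc)
  }
  {
    fix n :: nat assume n: "1 \<le> n"
    have "ratF m has_fps_expansion Abs_fps (\<lambda>n. (\<Sum>j\<in>?L. of_real (1 / eigval m j) ^ Suc n) / of_nat m ^ 2)"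
      by (rule has_fps_expansionI)
         (rule eventually_mono [OF eventually_norm_less_eigval [of m]],
           unfold fps_nth_Abs_fps, rule ratF_sums [OF m], blast)
    \<comment> \<open>Index n - 1 because that coefficient carries the power sum of order n.\<close>
    from fps_nth_fps_expansion [OF this, of "n - 1"]
    have "(\<Sum>j\<in>?L. of_real (1 / eigval m j) ^ n) =
        (of_nat m ^ 2 / fact (n - 1)) * (deriv ^^ (n - 1)) (ratF m) 0"
      using n m by (cases n) (simp_all add: field_simps)
    moreover have "(of_real ?c ^ n :: complex) = 3 ^ n * (of_nat m / 2) ^ (2 * n)"
      by (simp add: sc power_mult power_divide power_mult_distrib)
    ultimately show "of_real (verlinde n m) =
        3 ^ n * (of_nat m / 2) ^ (2 * n) * (of_nat m ^ 2 / fact (n - 1)) * (deriv ^^ (n - 1)) (ratF m) 0"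
      unfolding of_real_verlinde_conv_eigval [OF m] by (simp only: mult.assoc)
  }
  {
    let ?f = "\<lambda>n. if n = 0 then 0 else of_real (verlinde n m) :: complex"
    show "(\<lambda>\<tau>. of_real ?c * \<tau> * of_nat m ^ 2 * ratF m (of_real ?c * \<tau>)) has_fps_expansion Abs_fps ?f"
    proof (rule has_fps_expansionI)
      \<comment> \<open>The substitution w = c \<tau> is continuous at 0, so the expansion of
        \<open>ratF\<close> near 0 can be pulled back along it.\<close>
      have "((\<lambda>\<tau> :: complex. of_real ?c * \<tau>) \<longlongrightarrow> of_real ?c * 0) (nhds 0)"
        by (intro tendsto_intros filterlim_ident)
      hence "filterlim (\<lambda>\<tau> :: complex. of_real ?c * \<tau>) (nhds 0) (nhds 0)" by simp
      from eventually_compose_filterlim [OF eventually_norm_less_eigval [of m] this]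
      show "\<forall>\<^sub>F \<tau> in nhds 0. (\<lambda>n. fps_nth (Abs_fps ?f) n * \<tau> ^ n) sums
          (of_real ?c * \<tau> * of_nat m ^ 2 * ratF m (of_real ?c * \<tau>))"
      proof eventually_elim
        case (elim \<tau>)
        have "(\<lambda>n. of_real ?c * \<tau> * of_nat m ^ 2 *
            ((\<Sum>j\<in>?L. of_real (1 / eigval m j) ^ Suc n) / of_nat m ^ 2 * (of_real ?c * \<tau>) ^ n))
            sums (of_real ?c * \<tau> * of_nat m ^ 2 * ratF m (of_real ?c * \<tau>))"
          by (intro sums_mult ratF_sums [OF m]) (use elim in blast)
        \<comment> \<open>The prefactor c \<tau> supplies the missing power and moves coefficient n
          to n + 1, while m^2 cancels the normalisation of \<open>ratF\<close>.\<close>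
        moreover have "of_real ?c * \<tau> * of_nat m ^ 2 *
            ((\<Sum>j\<in>?L. of_real (1 / eigval m j) ^ Suc n) / of_nat m ^ 2 * (of_real ?c * \<tau>) ^ n) =
            ?f (Suc n) * \<tau> ^ Suc n" for n
          unfolding of_real_verlinde_conv_eigval [OF m] using m
          by (simp add: field_simps power_mult_distrib del: of_real_divide of_real_inverse)
        ultimately have "(\<lambda>n. ?f (Suc n) * \<tau> ^ Suc n)
            sums (of_real ?c * \<tau> * of_nat m ^ 2 * ratF m (of_real ?c * \<tau>))"
          by simp
        \<comment> \<open>The coefficient of index 0 is zero, so restoring it leaves the sum
          unchanged.\<close>
        thus ?case
          using sums_Suc_iff [of "\<lambda>n. ?f n * \<tau> ^ n"] by simp
      qed
    qed
  }
  fix R assume R: "R < Min (eigval m ` ?L) / ?c"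
  \<comment> \<open>Verlinde numbers are nonnegative, so the terms on the boundary circle dominate
    those on the whole disc.\<close>
  define M where "M = (\<lambda>n. verlinde (Suc n) m * \<bar>R\<bar> ^ Suc n)"
  have bound: "norm (of_real (verlinde (Suc n) m) * \<tau> ^ Suc n) \<le> M n" if "\<tau> \<in> cball 0 R" for n and \<tau> :: complex
  proof -
    have "verlinde (Suc n) m \<ge> 0"
      unfolding verlinde_conv_eigval [OF m] using c eigval_pos
      by (intro sum_nonneg zero_le_power divide_nonneg_nonneg) (auto intro: less_imp_le simp del: Diff_iff)
    moreover have "norm \<tau> \<le> \<bar>R\<bar>" using that by simp
    ultimately show ?thesis
      unfolding M_def norm_mult norm_power norm_of_real
      by (intro mult_mono power_mono) auto
  qed
  have M: "summable M" if "R \<ge> 0"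
  proof -
    \<comment> \<open>The majorant is a finite sum of geometric series with ratios c R / \<lambda>,
      all below 1 since c R is less than the smallest eigenvalue.\<close>
    have "summable (\<lambda>n. \<Sum>j\<in>?L. (?c * \<bar>R\<bar> / eigval m j) ^ Suc n)"
    proof (rule summable_sum)
      fix j assume j: "j \<in> ?L"
      have "R * ?c < Min (eigval m ` ?L)"
        using R c by (simp add: field_simps)
      also have "\<dots> \<le> eigval m j"
        using j by (intro Min_le) (auto simp: finite_modes simp del: Diff_iff)
      finally have "norm (?c * \<bar>R\<bar> / eigval m j) < 1"
        using c \<open>R \<ge> 0\<close> eigval_pos [OF j] by (simp add: abs_mult mult.commute)
      thus "summable (\<lambda>n. (?c * \<bar>R\<bar> / eigval m j) ^ Suc n)"
        by (subst summable_Suc_iff) (rule summable_geometric)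
    qed
    thus ?thesis
      unfolding M_def verlinde_conv_eigval [OF m] sum_distrib_right power_mult_distrib [symmetric]
      by (simp only: times_divide_eq_left)
  qed
  show "summable (\<lambda>n. norm (of_real (verlinde (Suc n) m) * \<tau> ^ Suc n))"
    if "\<tau> \<in> cball (0::complex) R" for \<tau>
  proof (rule summable_comparison_test')
    have "0 \<le> norm \<tau>" "norm \<tau> \<le> R" using that by auto
    thus "summable M" by (intro M) linarith
  qed (use bound [OF that] in \<open>simp del: norm_mult norm_of_real power_Suc\<close>)
  show "uniformly_convergent_on (cball (0::complex) R) (\<lambda>N \<tau>. \<Sum>n=1..N. of_real (verlinde n m) * \<tau> ^ n)"
  \<comment> \<open>For negative R the disc is empty and the claim is trivial; otherwise the
    Weierstrass M-test applies, up to a shift of the summation index.\<close>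
  proof (cases "R \<ge> 0")
    case True
    have "uniformly_convergent_on (cball (0::complex) R)
        (\<lambda>N \<tau>. \<Sum>n<N. of_real (verlinde (Suc n) m) * \<tau> ^ Suc n)"
      using bound M [OF True] by (rule Weierstrass_m_test')
    thus ?thesis
      by (simp only: One_nat_def sum.atLeast1_atMost_eq)
  qed simp
qed

end
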